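(* Let $T$ be an operator on a Banach space $Y$ and $X$ a closed subspace of $Y$ that is invariant under $T$. Let $\mathcal{A}$ be an upper Furstenberg family. Suppose that the following property holds: For all $x_2\in X$ and $\varepsilon_2>0$ there are $x_2'\in X$ and $\eta_2>0$ such that for all $x_1\in X$ and $\varepsilon_1>0$ there are $x_1'\in X$ and $\eta_1>0$ so that for all $y\in Y$ and all finite subsets $F\subset\mathbb{N}_0$, if $$\|x_1'-y\|<\eta_1\ \text{ and }\ \|x_2'-T^ny\|<\eta_2\ \text{ for all } n\in F,$$ then there is some $x\in X$ such that $$\|x_1-x\|<\varepsilon_1\ \text{ and }\ \|x_2-T^nx\|<\varepsilon_2\ \text{ for all } n\in F.$$ Then the following assertions are equivalent: (a) $T:Y\to Y$ is $\mathcal{A}$-hypercyclic for $X$. (b) $T:X\to X$ is $\mathcal{A}$-hypercyclic.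
   Context: Banach spaces are real or complex. An operator on a Banach space is a continuous linear self-map. A Furstenberg family is a non-empty family $\mathcal{A}$ of subsets of $\mathbb{N}_0$ such that $A\in\mathcal{A}$ and $A\subset B\subset\mathbb{N}_0$ imply $B\in\mathcal{A}$. A Furstenberg family $\mathcal{A}$ is called upper if it does not contain the empty set and it can be written as $\mathcal{A}=\bigcup_{\delta\in D}\mathcal{A}_\delta$ with $\mathcal{A}_\delta=\bigcap_{\mu\in M}\mathcal{A}_{\delta,\mu}$ for some families $\mathcal{A}_{\delta,\mu}$ of subsets of $\mathbb{N}_0$ ($\delta\in D,\mu\in M$), where $D$ is arbitrary but $M$ is countable, such that (i) for any $A\in\mathcal{A}_{\delta,\mu}$ there is a finite set $F\subset\mathbb{N}_0$ such that if $B\supset A\cap F$ then $B\in\mathcal{A}_{\delta,\mu}$; (ii) for any $A\in\mathcal{A}$ there is some $\delta\in D$ such that, for all $n\geq0$, $A-n\in\mathcal{A}_\delta$, where $A-n=\{k\geq0: k+n\in A\}$. An operator $T$ on a Banach space $X$ is $\mathcal{A}$-hypercyclic if there is a vector $x\in X$ such that, for any non-empty open subset $U$ of $X$, $\{n\geq0:T^nx\in U\}\in\mathcal{A}$. If $X$ is a closed subspace of a Banach space $Y$, an operator $T$ on $Y$ is $\mathcal{A}$-hypercyclic for $X$ if there is a vector $y\in Y$ such that, for any open subset $U$ of $Y$ with $U\cap X\neq\varnothing$, $\{n\geq0: T^ny\in U\}\in\mathcal{A}$. *)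

theory Defs
  imports "HOL-Analysis.Analysis"
begin

(* A Banach space over the scalar field 'k. The class banach only carries the real structure;
   smul is the scalar multiplication by 'k extending it. By the Gelfand-Mazur theorem, the
   fields of class real_normed_field are, up to isomorphism, exactly the real and the complex
   numbers, so this covers real and complex Banach spaces simultaneously. *)
locale banach_space_over = vector_space smul
  for smul :: "'k::real_normed_field \<Rightarrow> 'y::banach \<Rightarrow> 'y" +
  assumes norm_smul: "norm (smul a x) = norm a * norm x"
    and smul_of_real: "smul (of_real r) x = r *\<^sub>R x"

lemma banach_space_over_real:
  "banach_space_over (scaleR :: real \<Rightarrow> 'y::banach \<Rightarrow> 'y)"
  by unfold_locales (simp_all add: algebra_simps)

lemma banach_space_over_complex:
  "banach_space_over ((*) :: complex \<Rightarrow> complex \<Rightarrow> complex)"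
  by unfold_locales (simp_all add: algebra_simps norm_mult scaleR_conv_of_real)

definition operator_on :: "('k::real_normed_field \<Rightarrow> 'y::banach \<Rightarrow> 'y) \<Rightarrow> ('y \<Rightarrow> 'y) \<Rightarrow> bool" where
  "operator_on smul T \<longleftrightarrow> Vector_Spaces.linear smul smul T \<and> continuous_on UNIV T"

definition furstenberg_family :: "nat set set \<Rightarrow> bool" where
  "furstenberg_family \<A> \<longleftrightarrow> \<A> \<noteq> {} \<and> (\<forall>A B. A \<in> \<A> \<longrightarrow> A \<subseteq> B \<longrightarrow> B \<in> \<A>)"

definition shift_left :: "nat set \<Rightarrow> nat \<Rightarrow> nat set" where
  "shift_left A n = {k. k + n \<in> A}"

definition upper_representation ::
  "nat set set \<Rightarrow> 'd set \<Rightarrow> 'm set \<Rightarrow> ('d \<Rightarrow> 'm \<Rightarrow> nat set set) \<Rightarrow> bool" where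
  "upper_representation \<A> D M \<F> \<longleftrightarrow>
     countable M \<and>
     \<A> = (\<Union>\<delta>\<in>D. \<Inter>\<mu>\<in>M. \<F> \<delta> \<mu>) \<and>
     (\<forall>\<delta>\<in>D. \<forall>\<mu>\<in>M. \<forall>A\<in>\<F> \<delta> \<mu>. \<exists>F. finite F \<and> (\<forall>B. A \<inter> F \<subseteq> B \<longrightarrow> B \<in> \<F> \<delta> \<mu>)) \<and>
     (\<forall>A\<in>\<A>. \<exists>\<delta>\<in>D. \<forall>n. shift_left A n \<in> (\<Inter>\<mu>\<in>M. \<F> \<delta> \<mu>))"

(* One cannot quantify existentially over the types of the index sets D and M; the types chosen
   here are large enough for all index sets, see upper_furstenberg_familyI. *)
definition upper_furstenberg_family :: "nat set set \<Rightarrow> bool" where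
  "upper_furstenberg_family \<A> \<longleftrightarrow>
     furstenberg_family \<A> \<and> {} \<notin> \<A> \<and>
     (\<exists>(D :: (nat \<Rightarrow> nat set set) set) (M :: nat set) \<F>. upper_representation \<A> D M \<F>)"

lemma upper_furstenberg_familyI:
  fixes D :: "'d set" and M :: "'m set"
  assumes "furstenberg_family \<A>" "{} \<notin> \<A>" and rep: "upper_representation \<A> D M \<F>"
  shows "upper_furstenberg_family \<A>"
proof -
  define h where "h = from_nat_into M"
  define M' where "M' = to_nat_on M ` M"
  define D' where "D' = (\<lambda>\<delta> k. \<F> \<delta> (h k)) ` D"
  have M: "countable M" using rep by (simp add: upper_representation_def)
  have hM: "h ` M' = M"
    using M by (force simp: h_def M'_def image_image)
  have inter: "(\<Inter>k\<in>M'. \<F> \<delta> (h k)) = (\<Inter>\<mu>\<in>M. \<F> \<delta> \<mu>)" for \<delta>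
    using hM by (metis image_image)
  have hmem: "h k \<in> M" if "k \<in> M'" for k using hM that by blast
  have U: "\<A> = (\<Union>\<delta>\<in>D. \<Inter>\<mu>\<in>M. \<F> \<delta> \<mu>)"
    and fin: "\<forall>\<delta>\<in>D. \<forall>\<mu>\<in>M. \<forall>A\<in>\<F> \<delta> \<mu>. \<exists>F. finite F \<and> (\<forall>B. A \<inter> F \<subseteq> B \<longrightarrow> B \<in> \<F> \<delta> \<mu>)"
    and sh: "\<forall>A\<in>\<A>. \<exists>\<delta>\<in>D. \<forall>n. shift_left A n \<in> (\<Inter>\<mu>\<in>M. \<F> \<delta> \<mu>)"
    using rep unfolding upper_representation_def by blast+
  have "upper_representation \<A> D' M' (\<lambda>f k. f k)"
    unfolding upper_representation_def
  proof (intro conjI)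
    show "countable M'" by simp
    show "\<A> = (\<Union>f\<in>D'. \<Inter>k\<in>M'. f k)"
      unfolding D'_def U by (simp only: image_image inter)
    show "\<forall>f\<in>D'. \<forall>k\<in>M'. \<forall>A\<in>f k. \<exists>F. finite F \<and> (\<forall>B. A \<inter> F \<subseteq> B \<longrightarrow> B \<in> f k)"
      unfolding D'_def using fin hmem by blast
    show "\<forall>A\<in>\<A>. \<exists>f\<in>D'. \<forall>n. shift_left A n \<in> (\<Inter>k\<in>M'. f k)"
      using sh unfolding D'_def by (simp only: bex_simps inter)
  qed
  then show ?thesis
    using assms unfolding upper_furstenberg_family_def by blast
qed

(* X is a closed subspace invariant under T, regarded as a Banach space of its own, whose open
   sets are the relatively open ones. *)
definition hypercyclic_on ::
  "nat set set \<Rightarrow> 'y::banach set \<Rightarrow> ('y \<Rightarrow> 'y) \<Rightarrow> bool" where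
  "hypercyclic_on \<A> X T \<longleftrightarrow>
     (\<exists>x\<in>X. \<forall>U. openin (top_of_set X) U \<and> U \<noteq> {} \<longrightarrow> {n. (T ^^ n) x \<in> U} \<in> \<A>)"

definition hypercyclic_for ::
  "nat set set \<Rightarrow> 'y::banach set \<Rightarrow> ('y \<Rightarrow> 'y) \<Rightarrow> bool" where
  "hypercyclic_for \<A> X T \<longleftrightarrow>
     (\<exists>y. \<forall>U. open U \<and> U \<inter> X \<noteq> {} \<longrightarrow> {n. (T ^^ n) y \<in> U} \<in> \<A>)"

end

theory Submission
  imports Defs
begin

text \<open>
  One direction is immediate: a vector of \<open>X\<close> that is hypercyclic inside \<open>X\<close> visits every open set
  of the big space that meets \<open>X\<close>.  The converse is a Baire category argument in \<open>X\<close>.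

  Let \<open>y\<close> be hypercyclic for \<open>X\<close>.  Its orbit is countable and has \<open>X\<close> in its closure, so \<open>X\<close> is
  separable and it suffices to visit countably many balls with centre and radius taken from
  countable sets (\<open>ex_countable_dense_subset\<close>).  For such a ball \<open>V\<close>, with centre \<open>x2\<close> and radius
  \<open>\<epsilon>2\<close>, the transfer hypothesis provides a ball \<open>W\<close> centred in \<open>X\<close> such that finitely many visits of
  an orbit to \<open>W\<close> can be imitated by visits of an orbit in \<open>X\<close> to \<open>V\<close>.  The set \<open>A\<close> of times at which
  \<open>y\<close> visits \<open>W\<close> lies in \<open>\<A>\<close>, so there is one index \<open>\<delta>\<close> for which all shifts of \<open>A\<close> lie in
  \<open>\<A>\<^sub>\<delta>\<close>.  Now fix \<open>\<mu>\<close> and look at the set of \<open>x\<close> in \<open>X\<close> whose visits to \<open>V\<close> form a member of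
  \<open>\<A>\<^sub>\<delta>\<^sub>\<mu>\<close>.
    \<^item> It is open, because membership in \<open>\<A>\<^sub>\<delta>\<^sub>\<mu>\<close> is secured by finitely many visits
      (\<open>open_visiting_points\<close>).
    \<^item> It is dense in \<open>X\<close>: some iterate \<open>T\<^sup>m y\<close> comes close to any given point of \<open>X\<close>.  Its visits to
      \<open>W\<close> form the set \<open>A - m\<close>, a member of \<open>\<A>\<^sub>\<delta>\<^sub>\<mu>\<close>, and this is witnessed by finitely many visits,
      which the hypothesis transfers to a nearby point of \<open>X\<close> (\<open>transfer_finitely_many_visits\<close>).
  It is decisive here that \<open>\<delta>\<close> depends on the ball \<open>V\<close> only: then a countable intersection over the
  balls and over \<open>\<mu>\<close> yields a point whose visits to each \<open>V\<close> lie in \<open>\<A>\<^sub>\<delta> \<subseteq> \<A>\<close>.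
\<close>

section \<open>Visiting times of an orbit\<close>

text \<open>
  The condition imposed on each of the families \<open>\<A>\<^sub>\<delta>\<^sub>\<mu>\<close> of an upper Furstenberg family.  It says that
  \<open>\<G>\<close> is closed under supersets and open in the power set of the natural numbers with the product
  topology, which is how openness enters the category argument.
\<close>

definition finitely_determined :: "nat set set \<Rightarrow> bool" where
  "finitely_determined \<G> \<longleftrightarrow> (\<forall>A\<in>\<G>. \<exists>F. finite F \<and> (\<forall>B. A \<inter> F \<subseteq> B \<longrightarrow> B \<in> \<G>))"

definition visits :: "('a \<Rightarrow> 'a) \<Rightarrow> 'a \<Rightarrow> 'a set \<Rightarrow> nat set" where
  "visits T x V = {n. (T ^^ n) x \<in> V}"

lemma visits_funpow: "visits T ((T ^^ m) x) V = shift_left (visits T x V) m"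
  by (simp add: visits_def shift_left_def funpow_add)

lemma continuous_on_funpow:
  fixes T :: "'a::topological_space \<Rightarrow> 'a"
  assumes "continuous_on UNIV T"
  shows "continuous_on UNIV (T ^^ n)"
proof (induction n)
  case (Suc n)
  then show ?case
    using continuous_on_compose2[OF assms] by simp
qed (simp add: id_def)

lemma funpow_in_invariant:
  assumes "T ` X \<subseteq> X" "x \<in> X"
  shows "(T ^^ n) x \<in> X"
  using assms by (induction n) auto

lemma open_visiting_points:
  fixes T :: "'a::topological_space \<Rightarrow> 'a"
  assumes T: "continuous_on UNIV T" and "open V" and "finitely_determined \<G>"
  shows "open {x. visits T x V \<in> \<G>}"
proof (subst open_subopen, clarify)
  fix x assume "visits T x V \<in> \<G>"
  then obtain F where "finite F" and F: "\<And>B. visits T x V \<inter> F \<subseteq> B \<Longrightarrow> B \<in> \<G>"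
    using assms(3) unfolding finitely_determined_def by blast
  \<comment> \<open>the points that visit \<open>V\<close> at all the finitely many times in \<open>F\<close> at which \<open>x\<close> does\<close>
  let ?N = "\<Inter>n\<in>visits T x V \<inter> F. (T ^^ n) -` V"
  have "open ?N"
    using \<open>finite F\<close> continuous_on_funpow[OF T] \<open>open V\<close>
    by (intro open_INT) (auto intro: open_vimage)
  moreover have "x \<in> ?N"
    by (auto simp: visits_def)
  moreover have "?N \<subseteq> {z. visits T z V \<in> \<G>}"
    by (auto simp: visits_def intro!: F)
  ultimately show "\<exists>N. open N \<and> x \<in> N \<and> N \<subseteq> {z. visits T z V \<in> \<G>}"
    by blast
qed

section \<open>Separability and Baire category\<close>

text \<open>
  Separability is inherited by subsets of a metric space, stated relative to a countable set \<open>S\<close> that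
  need not lie in \<open>X\<close>: whenever a ball of radius \<open>1/(j+1)\<close> around a point of \<open>S\<close> meets \<open>X\<close>, one
  point of \<open>X\<close> in this ball is selected.
\<close>

lemma ex_countable_dense_subset:
  fixes X :: "'a::metric_space set"
  assumes "countable S" "X \<subseteq> closure S"
  shows "\<exists>D\<subseteq>X. countable D \<and> X \<subseteq> closure D"
proof -
  define I where "I = {(s, j::nat). s \<in> S \<and> X \<inter> ball s (1 / Suc j) \<noteq> {}}"
  define c where "c = (\<lambda>(s, j::nat). SOME x. x \<in> X \<inter> ball s (1 / Suc j))"
  have c: "c (s, j) \<in> X \<inter> ball s (1 / Suc j)" if "(s, j) \<in> I" for s j
    using that some_in_eq[of "X \<inter> ball s (1 / Suc j)"] by (simp add: I_def c_def)
  have "countable I"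
    by (rule countable_subset[of _ "S \<times> UNIV"]) (auto simp: I_def \<open>countable S\<close>)
  have "x \<in> closure (c ` I)" if "x \<in> X" for x
    unfolding closure_approachable
  proof (intro allI impI)
    fix e :: real assume "e > 0"
    then obtain j where j: "1 / Suc j < e / 2"
      by (metis half_gt_zero nat_approx_posE)
    have "x \<in> closure S" "(0::real) < 1 / Suc j"
      using that assms by auto
    then obtain s where s: "s \<in> S" "dist s x < 1 / Suc j"
      unfolding closure_approachable by blast
    then have "(s, j) \<in> I"
      using that by (auto simp: I_def)
    moreover from c[OF this] have "dist (c (s, j)) x < e"
      using s j dist_triangle[of "c (s, j)" x s] by (auto simp: dist_commute)
    ultimately show "\<exists>z\<in>c ` I. dist z x < e"
      by blast
  qed
  moreover have "c ` I \<subseteq> X"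
    using c by auto
  ultimately show ?thesis
    using \<open>countable I\<close> by blast
qed

text \<open>
  The Baire category theorem in the complete space \<open>X\<close>.  Each requirement \<open>(V, \<G>)\<close> holds on a
  relatively open set, so once each of them holds densely, countably many hold at once.
\<close>

lemma ex_point_with_prescribed_visits:
  fixes T :: "'a::complete_space \<Rightarrow> 'a"
  assumes T: "continuous_on UNIV T" and "closed X" "X \<noteq> {}" and "countable \<K>"
    and op: "\<And>V \<G>. (V, \<G>) \<in> \<K> \<Longrightarrow> open V \<and> finitely_determined \<G>"
    and dense: "\<And>V \<G> x1 \<epsilon>. \<lbrakk>(V, \<G>) \<in> \<K>; x1 \<in> X; \<epsilon> > 0\<rbrakk>
                  \<Longrightarrow> \<exists>x\<in>X. dist x1 x < \<epsilon> \<and> visits T x V \<in> \<G>"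
  shows "\<exists>x\<in>X. \<forall>(V, \<G>)\<in>\<K>. visits T x V \<in> \<G>"
proof -
  define R where "R = (\<lambda>(V, \<G>). X \<inter> {x. visits T x V \<in> \<G>})"
  have "openin (top_of_set X) (R k) \<and> top_of_set X closure_of R k = X" if "k \<in> \<K>" for k
  proof -
    obtain V \<G> where k: "k = (V, \<G>)" by fastforce
    have "openin (top_of_set X) (R k)"
      using open_visiting_points[OF T] op that unfolding k R_def by (auto intro: openin_open_Int)
    moreover have "X \<subseteq> closure (R k)"
    proof (clarsimp simp: closure_approachable)
      fix x1 \<epsilon> assume "x1 \<in> X" "(0::real) < \<epsilon>"
      then show "\<exists>x\<in>R k. dist x x1 < \<epsilon>"
        using dense[of V \<G> x1 \<epsilon>] that unfolding k R_def by (auto simp: dist_commute)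
    qed
    ultimately show ?thesis
      by (simp add: closure_of_subtopology openin_imp_subset inf.absorb1 inf.absorb2)
  qed
  moreover have "completely_metrizable_space (top_of_set X)"
    using \<open>closed X\<close> closed_closedin completely_metrizable_space_closedin
      completely_metrizable_space_euclidean by blast
  ultimately have "top_of_set X closure_of \<Inter>(R ` \<K>) = topspace (top_of_set X)"
    using \<open>countable \<K>\<close> by (intro Baire_category) auto
  then have "X \<inter> \<Inter>(R ` \<K>) \<noteq> {}"
    using \<open>X \<noteq> {}\<close> by (metis closure_of_eq_empty_gen disjnt_def inf_commute topspace_euclidean_subtopology)
  then show ?thesis
    by (auto simp: R_def)
qed

section \<open>From orbits near the subspace to orbits inside it\<close>

text \<open>
  The orbit of \<open>y\<close> need not start near \<open>x1'\<close>, but some iterate \<open>T\<^sup>m y\<close> does.  Its visits to the ball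
  around \<open>x2'\<close> are those of \<open>y\<close> shifted by \<open>m\<close>; since \<open>m\<close> depends on \<open>x1'\<close> and \<open>\<eta>1\<close>, all shifts have
  to belong to \<open>\<G>\<close>.
\<close>

lemma transfer_finitely_many_visits:
  fixes T :: "'a::metric_space \<Rightarrow> 'a"
  assumes near: "visits T y (ball x1' \<eta>1) \<noteq> {}"
    and shifts: "\<And>m. shift_left (visits T y (ball x2' \<eta>2)) m \<in> \<G>"
    and "finitely_determined \<G>"
    and transfer: "\<And>z F. \<lbrakk>finite F; dist x1' z < \<eta>1; \<forall>n\<in>F. dist x2' ((T ^^ n) z) < \<eta>2\<rbrakk>
      \<Longrightarrow> \<exists>x\<in>X. dist x1 x < \<epsilon>1 \<and> (\<forall>n\<in>F. dist x2 ((T ^^ n) x) < \<epsilon>2)"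
  shows "\<exists>x\<in>X. dist x1 x < \<epsilon>1 \<and> visits T x (ball x2 \<epsilon>2) \<in> \<G>"
proof -
  obtain m where m: "dist x1' ((T ^^ m) y) < \<eta>1"
    using near by (auto simp: visits_def)
  define z where "z = (T ^^ m) y"
  have "visits T z (ball x2' \<eta>2) \<in> \<G>"
    using shifts by (simp add: z_def visits_funpow)
  then obtain F where "finite F" and F: "\<And>B. visits T z (ball x2' \<eta>2) \<inter> F \<subseteq> B \<Longrightarrow> B \<in> \<G>"
    using assms(3) unfolding finitely_determined_def by blast
  then obtain x where "x \<in> X" "dist x1 x < \<epsilon>1"
      "\<forall>n\<in>visits T z (ball x2' \<eta>2) \<inter> F. dist x2 ((T ^^ n) x) < \<epsilon>2"
    using m transfer[of "visits T z (ball x2' \<eta>2) \<inter> F" z] by (auto simp: z_def visits_def)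
  then show ?thesis
    by (intro bexI[of _ x] conjI F) (auto simp: visits_def)
qed

lemma hypercyclic_for_if_hypercyclic_on:
  assumes "furstenberg_family \<A>" "hypercyclic_on \<A> X T"
  shows "hypercyclic_for \<A> X T"
proof -
  obtain x where x: "\<And>U. openin (top_of_set X) U \<Longrightarrow> U \<noteq> {} \<Longrightarrow> {n. (T ^^ n) x \<in> U} \<in> \<A>"
    using assms(2) unfolding hypercyclic_on_def by blast
  have "{n. (T ^^ n) x \<in> U} \<in> \<A>" if "open U" "U \<inter> X \<noteq> {}" for U
  proof -
    have "{n. (T ^^ n) x \<in> X \<inter> U} \<in> \<A>"
      using that by (intro x) (auto simp: openin_open)
    moreover have "{n. (T ^^ n) x \<in> X \<inter> U} \<subseteq> {n. (T ^^ n) x \<in> U}"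
      by auto
    ultimately show ?thesis
      using assms(1) unfolding furstenberg_family_def by blast
  qed
  then show ?thesis
    unfolding hypercyclic_for_def by blast
qed

text \<open>
  Every relatively open set contains the trace on \<open>X\<close> of one of the given balls, and the orbit stays in
  \<open>X\<close>, so upward closure of \<open>\<A>\<close> does the rest.  For countable \<open>D\<close> this leaves countably many
  requirements.
\<close>

lemma hypercyclic_onI_dense:
  assumes "furstenberg_family \<A>" "T ` X \<subseteq> X" "X \<subseteq> closure D" "x \<in> X"
    and balls: "\<And>d j::nat. d \<in> D \<Longrightarrow> visits T x (ball d (1 / Suc j)) \<in> \<A>"
  shows "hypercyclic_on \<A> X T"
  unfolding hypercyclic_on_def
proof (intro bexI[of _ x] allI impI)
  fix U assume U: "openin (top_of_set X) U \<and> U \<noteq> {}"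
  then obtain u e where "u \<in> U" "e > 0" and e: "ball u e \<inter> X \<subseteq> U"
    by (metis openin_contains_ball ex_in_conv)
  obtain j where j: "1 / Suc j < e / 2"
    using \<open>e > 0\<close> by (metis half_gt_zero nat_approx_posE)
  have "u \<in> closure D" "(0::real) < 1 / Suc j"
    using \<open>u \<in> U\<close> U assms(3) openin_imp_subset by fastforce+
  then obtain d where d: "d \<in> D" "dist d u < 1 / Suc j"
    unfolding closure_approachable by blast
  have "ball d (1 / Suc j) \<subseteq> ball u e"
  proof
    fix z assume "z \<in> ball d (1 / Suc j)"
    then show "z \<in> ball u e"
      using d j dist_triangle[of u z d] by (auto simp: dist_commute)
  qed
  then have "visits T x (ball d (1 / Suc j)) \<subseteq> {n. (T ^^ n) x \<in> U}"
    using e funpow_in_invariant[OF assms(2) \<open>x \<in> X\<close>] by (simp add: visits_def subset_iff)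
  then show "{n. (T ^^ n) x \<in> U} \<in> \<A>"
    using balls[OF d(1)] assms(1) unfolding furstenberg_family_def by blast
qed fact

theorem theorem10:
  fixes smul :: "'k::real_normed_field \<Rightarrow> 'y::banach \<Rightarrow> 'y"
    and T :: "'y \<Rightarrow> 'y" and X :: "'y set" and \<A> :: "nat set set"
  assumes "banach_space_over smul"
    and "operator_on smul T"
    and "module.subspace smul X" and "closed X" and "T ` X \<subseteq> X"
    and "upper_furstenberg_family \<A>"
    and "\<forall>x2\<in>X. \<forall>\<epsilon>2>0. \<exists>x2'\<in>X. \<exists>\<eta>2>0. \<forall>x1\<in>X. \<forall>\<epsilon>1>0. \<exists>x1'\<in>X. \<exists>\<eta>1>0.
           \<forall>y. \<forall>F::nat set. finite F \<longrightarrow>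
             norm (x1' - y) < \<eta>1 \<and> (\<forall>n\<in>F. norm (x2' - (T ^^ n) y) < \<eta>2) \<longrightarrow>
             (\<exists>x\<in>X. norm (x1 - x) < \<epsilon>1 \<and> (\<forall>n\<in>F. norm (x2 - (T ^^ n) x) < \<epsilon>2))"
  shows "hypercyclic_for \<A> X T \<longleftrightarrow> hypercyclic_on \<A> X T"
proof
  have furst: "furstenberg_family \<A>" and "{} \<notin> \<A>"
    using assms(6) by (auto simp: upper_furstenberg_family_def)
  show "hypercyclic_for \<A> X T" if "hypercyclic_on \<A> X T"
    using furst that by (rule hypercyclic_for_if_hypercyclic_on)
  assume "hypercyclic_for \<A> X T"
  then obtain y where y: "\<And>U. open U \<Longrightarrow> U \<inter> X \<noteq> {} \<Longrightarrow> visits T y U \<in> \<A>"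
    unfolding hypercyclic_for_def visits_def by blast
  have y_ball: "visits T y (ball c r) \<in> \<A>" if "c \<in> X" "r > 0" for c r
    using that by (intro y) (auto simp: disjoint_iff intro!: exI[of _ c])
  have T: "continuous_on UNIV T"
    using assms(2) by (simp add: operator_on_def)
  have "X \<noteq> {}"
  proof -
    interpret banach_space_over smul by fact
    show ?thesis using assms(3) subspace_0 by blast
  qed
  obtain DD :: "(nat \<Rightarrow> nat set set) set" and M :: "nat set" and \<F>
    where rep: "upper_representation \<A> DD M \<F>"
    using assms(6) by (auto simp: upper_furstenberg_family_def)
  note rep = rep[unfolded upper_representation_def, folded finitely_determined_def]
  have rep_Un: "\<A> = (\<Union>\<delta>\<in>DD. \<Inter>\<mu>\<in>M. \<F> \<delta> \<mu>)"
    using rep by (elim conjE)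
  have rep_fin: "\<forall>\<delta>\<in>DD. \<forall>\<mu>\<in>M. finitely_determined (\<F> \<delta> \<mu>)"
    using rep by (elim conjE)
  have rep_shift: "\<forall>A\<in>\<A>. \<exists>\<delta>\<in>DD. \<forall>n. shift_left A n \<in> (\<Inter>\<mu>\<in>M. \<F> \<delta> \<mu>)"
    using rep by (elim conjE)
  have "X \<subseteq> closure (range (\<lambda>n. (T ^^ n) y))"
  proof (clarsimp simp: closure_approachable)
    fix x and e :: real assume "x \<in> X" "0 < e"
    then have "visits T y (ball x e) \<noteq> {}"
      using y_ball \<open>{} \<notin> \<A>\<close> by metis
    then show "\<exists>n. dist ((T ^^ n) y) x < e"
      by (auto simp: visits_def dist_commute)
  qed
  then obtain D where D: "D \<subseteq> X" "countable D" "X \<subseteq> closure D"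
    using ex_countable_dense_subset by (metis countable_image countableI_type)
  \<comment> \<open>One \<open>\<delta>\<close> has to serve all \<open>x1\<close> and \<open>\<epsilon>1\<close>, so that density holds for a fixed family; this is
    possible because the ball around \<open>x2'\<close> is provided before \<open>x1\<close> and \<open>\<epsilon>1\<close> are.\<close>
  have "\<exists>\<delta>\<in>DD. \<forall>\<mu>\<in>M. \<forall>x1\<in>X. \<forall>\<epsilon>1>0.
          \<exists>x\<in>X. dist x1 x < \<epsilon>1 \<and> visits T x (ball d (1 / Suc j)) \<in> \<F> \<delta> \<mu>"
    if "d \<in> D" for d and j :: nat
  proof -
    have "d \<in> X" "(0::real) < 1 / Suc j"
      using that D by auto
    then obtain x2' \<eta>2 where "x2' \<in> X" "\<eta>2 > 0" and
      tr: "\<forall>x1\<in>X. \<forall>\<epsilon>1>0. \<exists>x1'\<in>X. \<exists>\<eta>1>0. \<forall>y. \<forall>F::nat set. finite F \<longrightarrow>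
             norm (x1' - y) < \<eta>1 \<and> (\<forall>n\<in>F. norm (x2' - (T ^^ n) y) < \<eta>2) \<longrightarrow>
             (\<exists>x\<in>X. norm (x1 - x) < \<epsilon>1 \<and> (\<forall>n\<in>F. norm (d - (T ^^ n) x) < 1 / Suc j))"
      using assms(7)[rule_format, OF \<open>d \<in> X\<close> \<open>0 < 1 / Suc j\<close>] by (elim bexE exE conjE) (rule that)
    have "visits T y (ball x2' \<eta>2) \<in> \<A>"
      using y_ball \<open>x2' \<in> X\<close> \<open>\<eta>2 > 0\<close> .
    then obtain \<delta> where "\<delta> \<in> DD" and
      \<delta>: "\<And>m \<mu>. \<mu> \<in> M \<Longrightarrow> shift_left (visits T y (ball x2' \<eta>2)) m \<in> \<F> \<delta> \<mu>"
      using rep_shift by (meson INT_D)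
    have "\<exists>x\<in>X. dist x1 x < \<epsilon>1 \<and> visits T x (ball d (1 / Suc j)) \<in> \<F> \<delta> \<mu>"
      if "\<mu> \<in> M" "x1 \<in> X" "\<epsilon>1 > 0" for \<mu> x1 \<epsilon>1
    proof -
      obtain x1' \<eta>1 where "x1' \<in> X" "\<eta>1 > 0" and
        tr1: "\<forall>y. \<forall>F::nat set. finite F \<longrightarrow>
             norm (x1' - y) < \<eta>1 \<and> (\<forall>n\<in>F. norm (x2' - (T ^^ n) y) < \<eta>2) \<longrightarrow>
             (\<exists>x\<in>X. norm (x1 - x) < \<epsilon>1 \<and> (\<forall>n\<in>F. norm (d - (T ^^ n) x) < 1 / Suc j))"
        using tr[rule_format, OF \<open>x1 \<in> X\<close> \<open>\<epsilon>1 > 0\<close>] by (elim bexE exE conjE) (rule that)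
      show ?thesis
      proof (rule transfer_finitely_many_visits)
        show "visits T y (ball x1' \<eta>1) \<noteq> {}"
          using y_ball \<open>{} \<notin> \<A>\<close> \<open>x1' \<in> X\<close> \<open>\<eta>1 > 0\<close> by metis
        show "finitely_determined (\<F> \<delta> \<mu>)"
          using rep_fin \<open>\<delta> \<in> DD\<close> \<open>\<mu> \<in> M\<close> by simp
        show "shift_left (visits T y (ball x2' \<eta>2)) m \<in> \<F> \<delta> \<mu>" for m
          using \<delta> \<open>\<mu> \<in> M\<close> .
        show "\<exists>x\<in>X. dist x1 x < \<epsilon>1 \<and> (\<forall>n\<in>F. dist d ((T ^^ n) x) < 1 / Suc j)"
          if "finite F" "dist x1' z < \<eta>1" "\<forall>n\<in>F. dist x2' ((T ^^ n) z) < \<eta>2" for z F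
          using tr1[rule_format, OF that(1), of z] that(2,3) by (simp add: dist_norm)
      qed
    qed
    with \<open>\<delta> \<in> DD\<close> show ?thesis by blast
  qed
  then obtain \<Delta> where \<Delta>: "\<And>d j. d \<in> D \<Longrightarrow> \<Delta> d j \<in> DD"
    and \<Delta>_dense: "\<And>d j \<mu> x1 \<epsilon>1. \<lbrakk>d \<in> D; \<mu> \<in> M; x1 \<in> X; \<epsilon>1 > 0\<rbrakk>
        \<Longrightarrow> \<exists>x\<in>X. dist x1 x < \<epsilon>1 \<and> visits T x (ball d (1 / Suc j)) \<in> \<F> (\<Delta> d j) \<mu>"
    by metis
  define \<K> where
    "\<K> = (\<lambda>(d, j::nat, \<mu>). (ball d (1 / Suc j), \<F> (\<Delta> d j) \<mu>)) ` (D \<times> UNIV \<times> M)"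
  have "\<exists>x\<in>X. \<forall>(V, \<G>)\<in>\<K>. visits T x V \<in> \<G>"
  proof (rule ex_point_with_prescribed_visits[OF T \<open>closed X\<close> \<open>X \<noteq> {}\<close>])
    show "countable \<K>"
      unfolding \<K>_def using \<open>countable D\<close> by (intro countable_image countable_SIGMA) auto
    show "open V \<and> finitely_determined \<G>" if "(V, \<G>) \<in> \<K>" for V \<G>
      using that rep_fin \<Delta> unfolding \<K>_def by auto
    show "\<exists>x\<in>X. dist x1 x < \<epsilon> \<and> visits T x V \<in> \<G>"
      if "(V, \<G>) \<in> \<K>" "x1 \<in> X" "\<epsilon> > 0" for V \<G> x1 \<epsilon>
      using that(1) \<Delta>_dense[OF _ _ that(2,3)] unfolding \<K>_def by auto
  qed
  then obtain x where "x \<in> X" and x: "\<forall>(V, \<G>)\<in>\<K>. visits T x V \<in> \<G>"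
    by blast
  have "visits T x (ball d (1 / Suc j)) \<in> \<F> (\<Delta> d j) \<mu>" if "d \<in> D" "\<mu> \<in> M" for d j \<mu>
    using bspec[OF x, of "(ball d (1 / Suc j), \<F> (\<Delta> d j) \<mu>)"] that by (force simp: \<K>_def)
  then have "visits T x (ball d (1 / Suc j)) \<in> \<A>" if "d \<in> D" for d and j :: nat
    using rep_Un \<Delta>[OF that] that by blast
  then show "hypercyclic_on \<A> X T"
    using hypercyclic_onI_dense[OF furst assms(5) D(3) \<open>x \<in> X\<close>] by blast
qed

end
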